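(* Let $G$ be a block graph and let $k\ge 0$ be an integer. Then $\ddot{\gamma}_P^k(G)=(k+1)\gamma_P(G)$.
   Context: All graphs are finite, simple, undirected, with nonempty vertex set. A block of a connected graph $G$ is a maximal connected induced subgraph of $G$ that has no cut-vertex (of itself). A block graph is a connected graph in which every block is a complete graph. For $S\subseteq V(G)$ the power domination process is: (1) start with the observed set $N[S]$ (the union of closed neighborhoods of vertices of $S$); (2) while some observed vertex has exactly one unobserved neighbor $w$, add $w$ to the observed set. $S$ is a power dominating set if eventually all vertices are observed. $\gamma_P(G)$ is the minimum cardinality of a power dominating set. For an integer $k\ge 0$, a multiset $S$ of vertices of $G$ is a $k$-PMU-defect-robust power dominating set ($k$-rPDS) if $|S|\ge k$ and for every submultiset $F$ of $S$ with $|F|=k$, the underlying set of $S\setminus F$ (multiset difference) contains a power dominating set of $G$. Cardinalities of multisets count multiplicity. $\ddot{\gamma}_P^k(G)$ is the minimum cardinality of a $k$-rPDS of $G$. *)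

theory Defs
  imports "Graph_Theory.Graph_Theory" "HOL-Library.Multiset"
begin

text \<open>
  Finite simple undirected graphs are the symmetric digraphs of the locale \<^locale>\<open>graph\<close>:
  finite, loop-free, without parallel arcs, each edge being a pair of opposite arcs.
  There \<^const>\<open>connected\<close> includes that the vertex set is nonempty.
\<close>

subsection \<open>Block graphs\<close>

text \<open>A cut-vertex separates two other vertices lying in the same component.\<close>

definition cut_vertex :: "('a, 'b) pre_digraph \<Rightarrow> 'a \<Rightarrow> bool" where
  "cut_vertex G v \<longleftrightarrow> v \<in> verts G \<and>
     (\<exists>u \<in> verts G - {v}. \<exists>w \<in> verts G - {v}.
        u \<rightarrow>\<^sup>*\<^bsub>G\<^esub> w \<and> \<not> u \<rightarrow>\<^sup>*\<^bsub>pre_digraph.del_vert G v\<^esub> w)"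

text \<open>
  An induced subgraph is determined by its vertex set, so maximality is expressed by
  strict inclusion of vertex sets.
\<close>

definition block :: "('a, 'b) pre_digraph \<Rightarrow> ('a, 'b) pre_digraph \<Rightarrow> bool" where
  "block G B \<longleftrightarrow>
     induced_subgraph B G \<and> connected B \<and> (\<nexists>v. cut_vertex B v) \<and>
     \<not> (\<exists>B'. induced_subgraph B' G \<and> connected B' \<and> (\<nexists>v. cut_vertex B' v) \<and>
            verts B \<subset> verts B')"

definition block_graph :: "('a, 'b) pre_digraph \<Rightarrow> bool" where
  "block_graph G \<longleftrightarrow> graph G \<and> connected G \<and>
     (\<forall>B. block G B \<longrightarrow> complete_digraph (card (verts B)) B)"

subsection \<open>Power domination\<close>

definition closed_neighborhood :: "('a, 'b) pre_digraph \<Rightarrow> 'a set \<Rightarrow> 'a set" where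
  "closed_neighborhood G S = S \<union> {w. \<exists>v \<in> S. v \<rightarrow>\<^bsub>G\<^esub> w}"

text \<open>One propagation step; the second argument is the set of observed vertices.\<close>

inductive pd_step :: "('a, 'b) pre_digraph \<Rightarrow> 'a set \<Rightarrow> 'a set \<Rightarrow> bool" for G where
  "v \<in> X \<Longrightarrow> {u. v \<rightarrow>\<^bsub>G\<^esub> u \<and> u \<notin> X} = {w} \<Longrightarrow> pd_step G X (insert w X)"

text \<open>
  The final observed set does not depend on the order in which the steps are performed, so
  it suffices to ask for one run of the process that reaches the whole vertex set.
\<close>

definition power_dominating_set :: "('a, 'b) pre_digraph \<Rightarrow> 'a set \<Rightarrow> bool" where
  "power_dominating_set G S \<longleftrightarrow>
     S \<subseteq> verts G \<and> (pd_step G)\<^sup>*\<^sup>* (closed_neighborhood G S) (verts G)"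

definition power_domination_number :: "('a, 'b) pre_digraph \<Rightarrow> nat" where
  "power_domination_number G = (LEAST n. \<exists>S. power_dominating_set G S \<and> card S = n)"

definition k_rPDS :: "nat \<Rightarrow> ('a, 'b) pre_digraph \<Rightarrow> 'a multiset \<Rightarrow> bool" where
  "k_rPDS k G S \<longleftrightarrow> set_mset S \<subseteq> verts G \<and> size S \<ge> k \<and>
     (\<forall>F. F \<subseteq># S \<and> size F = k \<longrightarrow>
        (\<exists>T. T \<subseteq> set_mset (S - F) \<and> power_dominating_set G T))"

definition k_rPDS_number :: "nat \<Rightarrow> ('a, 'b) pre_digraph \<Rightarrow> nat" where
  "k_rPDS_number k G = (LEAST n. \<exists>S. k_rPDS k G S \<and> size S = n)"

text \<open>Both minima range over nonempty sets.\<close>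

lemma (in wf_digraph) power_dominating_set_verts: "power_dominating_set G (verts G)"
proof -
  have "closed_neighborhood G (verts G) = verts G"
    by (auto simp: closed_neighborhood_def dest: adj_in_verts)
  then show ?thesis by (simp add: power_dominating_set_def)
qed

lemma (in graph) k_rPDS_exists:
  assumes "verts G \<noteq> {}"
  shows "\<exists>S. k_rPDS k G S"
proof -
  let ?S = "repeat_mset (Suc k) (mset_set (verts G))"
  have "size ?S \<ge> k"
  proof -
    have "card (verts G) \<ge> 1" using assms finite_verts by (simp add: card_gt_0_iff Suc_leI)
    then show ?thesis by (cases "card (verts G)") simp_all
  qed
  moreover have "verts G \<subseteq> set_mset (?S - F)" if "size F = k" for F
  proof
    fix v assume "v \<in> verts G"
    then have "count ?S v = Suc k" by simp
    moreover have "count F v \<le> k" using that count_le_size by metis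
    ultimately have "count (?S - F) v > 0" by simp
    then show "v \<in> set_mset (?S - F)" by (simp only: count_greater_zero_iff)
  qed
  moreover have "set_mset ?S \<subseteq> verts G"
  proof
    fix x assume "x \<in> set_mset ?S"
    then have "count ?S x \<noteq> 0" by (simp only: count_eq_zero_iff) simp
    then show "x \<in> verts G" by (cases "x \<in> verts G") simp_all
  qed
  ultimately have "k_rPDS k G ?S"
    unfolding k_rPDS_def using power_dominating_set_verts by blast
  then show ?thesis ..
qed

end

theory Submission
  imports Defs
begin

text \<open>
  A fort is a nonempty vertex set \<open>F\<close> such that no vertex outside \<open>F\<close> has exactly one neighbour
  in \<open>F\<close>. Every power dominating set meets \<open>N[F]\<close>, hence a \<open>k\<close>-rPDS has at least \<open>k + 1\<close> elements
  in \<open>N[F]\<close>. So it suffices to find a power dominating set \<open>S\<close> and \<open>card S\<close> forts with pairwise disjoint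
  closed neighbourhoods.

  Root the block graph and treat the vertices bottom-up along the dominator tree. Put \<open>v\<close> into \<open>S\<close>
  only if the vertices already chosen below \<open>v\<close> fail to observe everything below \<open>v\<close>, even when \<open>v\<close> and
  everything not below \<open>v\<close> are observed for free. The vertices that remain unobserved then form a fort.
  Since blocks are complete, each \<open>v\<close> in \<open>S\<close> makes everything below it observed, so the forts
  arising further up stay away from that part of the graph.
\<close>

section \<open>Cycles in block graphs\<close>

lemma successively_rtrancl_on:
  assumes "successively (\<lambda>x y. (x, y) \<in> r) xs" "xs \<noteq> []" "set xs \<subseteq> A"
  shows "(hd xs, last xs) \<in> rtrancl_on A r"
  using assms
proof (induction xs rule: induct_list012)
  case (3 x y zs)
  then show ?case
    using converse_rtrancl_on_into_rtrancl_on[of x y r] by auto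
qed auto

lemma rtrancl_on_distinct_path:
  assumes "(x, y) \<in> rtrancl_on A r"
  obtains xs where "successively (\<lambda>u v. (u, v) \<in> r) xs" "distinct xs" "xs \<noteq> []" "set xs \<subseteq> A"
    "hd xs = x" "last xs = y"
  using assms
proof (induction arbitrary: thesis rule: rtrancl_on_induct)
  case base
  show ?case by (rule base(2)[of "[x]"]) (use base in auto)
next
  case (step y z)
  obtain xs where xs: "successively (\<lambda>u v. (u, v) \<in> r) xs" "distinct xs" "xs \<noteq> []" "set xs \<subseteq> A"
    "hd xs = x" "last xs = y"
    using step.IH by blast
  show ?case
  proof (cases "z \<in> set xs")
    case True
    \<comment> \<open>If \<open>z\<close> was visited before, the path is cut back to that visit,
      which keeps it distinct.\<close>
    then obtain ys zs where [simp]: "xs = ys @ z # zs" by (meson split_list)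
    show ?thesis
      by (rule step.prems[of "ys @ [z]"])
        (use xs in \<open>auto simp: successively_append_iff hd_append split: if_splits\<close>)
  next
    case False
    show ?thesis
      by (rule step.prems[of "xs @ [z]"])
        (use xs False step.hyps in \<open>auto simp: successively_append_iff\<close>)
  qed
qed

section \<open>Induced subgraphs seen through their vertex sets\<close>

context graph
begin

abbreviation reach_in :: "'a set \<Rightarrow> 'a \<Rightarrow> 'a \<Rightarrow> bool" where
  "reach_in A x y \<equiv> (x, y) \<in> rtrancl_on A (arcs_ends G)"

lemma adj_commute: "u \<rightarrow> v \<longleftrightarrow> v \<rightarrow> u"
  by (blast intro: graph_symmetric)

lemma reach_in_sym: "reach_in A x y \<Longrightarrow> reach_in A y x"
  using rtrancl_on_sym[of "arcs_ends G" A] sym_arcs unfolding symmetric_def by (meson symE)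

lemma reach_in_delete_step:
  "reach_in (verts G - {a}) x y \<Longrightarrow> y \<rightarrow> z \<Longrightarrow> z \<noteq> a \<Longrightarrow> reach_in (verts G - {a}) x z"
  by (blast intro: rtrancl_on_into_rtrancl_on adj_in_verts)

lemma reachable_induce_subgraph: "x \<rightarrow>\<^sup>*\<^bsub>G \<restriction> A\<^esub> y \<longleftrightarrow> reach_in A x y"
proof
  assume "x \<rightarrow>\<^sup>*\<^bsub>G \<restriction> A\<^esub> y"
  then show "reach_in A x y"
    unfolding reachable_def
    by (auto intro: rtrancl_on_mono[of "arcs_ends (G \<restriction> A)" _ A A] dest: dominates_induce_subgraphD)
next
  assume "reach_in A x y"
  then have "(x, y) \<in> rtrancl_on A (arcs_ends (G \<restriction> A))"
  proof (induction rule: rtrancl_on_induct)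
    case (step y z)
    then have "(y, z) \<in> arcs_ends (G \<restriction> A)" by (auto simp: arcs_ends_conv)
    with step show ?case by (meson rtrancl_on_into_rtrancl_on)
  qed auto
  then show "x \<rightarrow>\<^sup>*\<^bsub>G \<restriction> A\<^esub> y" by (simp add: reachable_def)
qed

lemma del_vert_induce_subgraph: "pre_digraph.del_vert (G \<restriction> A) a = G \<restriction> (A - {a})"
  by (auto simp: pre_digraph.del_vert_def induce_subgraph_def)

text \<open>The maximal such sets are the vertex sets of the blocks; as subsets of
  \<open>verts G\<close> there are only finitely many.\<close>

definition nonseparable :: "'a set \<Rightarrow> bool" where
  "nonseparable A \<longleftrightarrow> A \<subseteq> verts G \<and> connected (G \<restriction> A) \<and> (\<nexists>v. cut_vertex (G \<restriction> A) v)"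

text \<open>\<open>conn\<close> is asked separately because the vertex type may contain no
  \<open>a\<close> outside \<open>A\<close>, for which \<open>reach\<close> would give connectivity
  of \<open>A\<close> itself.\<close>

lemma nonseparableI:
  assumes "A \<subseteq> verts G" "A \<noteq> {}"
    and reach: "\<And>a x y. x \<in> A - {a} \<Longrightarrow> y \<in> A - {a} \<Longrightarrow> reach_in (A - {a}) x y"
    and conn: "\<And>x y. x \<in> A \<Longrightarrow> y \<in> A \<Longrightarrow> reach_in A x y"
  shows "nonseparable A"
proof -
  have "(x, y) \<in> rtrancl_on A ((arcs_ends (G \<restriction> A))\<^sup>s)" if "x \<in> A" "y \<in> A" for x y
  proof -
    have "x \<rightarrow>\<^sup>*\<^bsub>G \<restriction> A\<^esub> y" using conn that reachable_induce_subgraph by blast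
    then show ?thesis
      unfolding reachable_def by (auto simp: symcl_def intro: rtrancl_on_mono[rotated 2])
  qed
  then have "connected (G \<restriction> A)" using assms(2) by (simp add: connected_conv)
  moreover have "\<not> cut_vertex (G \<restriction> A) v" for v
    using reach by (auto simp: cut_vertex_def del_vert_induce_subgraph reachable_induce_subgraph)
  ultimately show ?thesis using assms(1) by (simp add: nonseparable_def)
qed

lemma induced_subgraph_eq: "induced_subgraph H G \<Longrightarrow> H = G \<restriction> verts H"
  by (auto simp: induced_subgraph_def subgraph_def compatible_def induce_subgraph_def)

lemma nonseparable_in_block:
  assumes "nonseparable A"
  obtains B where "block G B" "A \<subseteq> verts B"
proof -
  let ?N = "{B. nonseparable B \<and> A \<subseteq> B}"
  have "finite ?N"
    by (rule finite_subset[of _ "Pow (verts G)"]) (auto simp: nonseparable_def)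
  moreover have "A \<in> ?N" using assms by simp
  ultimately obtain B where "B \<in> ?N" and max: "\<And>C. C \<in> ?N \<Longrightarrow> B \<subseteq> C \<Longrightarrow> B = C"
    using finite_has_maximal2[of ?N A] by metis
  then have B: "nonseparable B" "A \<subseteq> B" by simp_all
  have "\<not> B \<subset> verts H"
    if "induced_subgraph H G" "connected H" "\<nexists>v. cut_vertex H v" for H
  proof
    assume "B \<subset> verts H"
    moreover have "nonseparable (verts H)"
      unfolding nonseparable_def
    proof (intro conjI)
      have eq: "G \<restriction> verts H = H" by (rule induced_subgraph_eq[OF that(1), symmetric])
      show "verts H \<subseteq> verts G"
        by (rule subgraph_imp_subverts[OF induced_imp_subgraph[OF that(1)]])
      show "connected (G \<restriction> verts H)" unfolding eq by (rule that(2))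
      show "\<nexists>v. cut_vertex (G \<restriction> verts H) v" unfolding eq by (rule that(3))
    qed
    ultimately show False using B(2) max[of "verts H"] by auto
  qed
  then have "block G (G \<restriction> B)"
    unfolding block_def
  proof (intro conjI notI)
    show "induced_subgraph (G \<restriction> B) G" "connected (G \<restriction> B)"
      using B(1) by (auto simp: nonseparable_def)
    show False if "\<exists>v. cut_vertex (G \<restriction> B) v"
      using B(1) that by (simp add: nonseparable_def)
  qed auto
  then show thesis using that B(2) by simp
qed

text \<open>\<open>c\<close> closes the path \<open>xs\<close> to a cycle, or to an edge if
  \<open>xs\<close> has one entry. After deletion of another vertex \<open>a\<close>, each remaining
  vertex still reaches \<open>c\<close> in the direction that avoids \<open>a\<close>; deletion of
  \<open>c\<close> leaves the path.\<close>

lemma cycle_nonseparable: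
  assumes xs: "successively (\<lambda>x y. x \<rightarrow> y) xs" "distinct xs" "xs \<noteq> []" "c \<notin> set xs"
    and c: "c \<rightarrow> hd xs" "c \<rightarrow> last xs" and verts: "set xs \<subseteq> verts G"
  shows "nonseparable (insert c (set xs))"
proof (rule nonseparableI)
  let ?A = "insert c (set xs)"
  have hub: "reach_in (?A - {a}) c y" if "a \<noteq> c" "y \<in> ?A - {a}" for a y
  proof (cases "y = c")
    case True
    then show ?thesis using that by (simp add: rtrancl_on_refl)
  next
    case False
    with that have "y \<in> set xs" by blast
    then obtain ys zs where split: "xs = ys @ y # zs" by (meson split_list)
    show ?thesis
    proof (cases "a \<in> set ys")
      case True
      then have "set (y # zs) \<subseteq> ?A - {a}" using that xs(2) split by auto
      moreover have "successively (\<lambda>x y. x \<rightarrow> y) (y # zs)"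
        using xs split by (simp add: successively_append_iff)
      ultimately have "reach_in (?A - {a}) y (last xs)"
        using successively_rtrancl_on[of "arcs_ends G" "y # zs"] split by simp
      then have "reach_in (?A - {a}) y c"
        by (rule rtrancl_on_into_rtrancl_on[OF _ graph_symmetric[OF c(2)]]) (use that in auto)
      then show ?thesis by (rule reach_in_sym)
    next
      case False
      then have "set (ys @ [y]) \<subseteq> ?A - {a}" using that split by auto
      moreover have "successively (\<lambda>x y. x \<rightarrow> y) (ys @ [y])"
        using xs split by (simp add: successively_append_iff)
      moreover have "hd (ys @ [y]) = hd xs" using split by (cases ys) auto
      ultimately have "reach_in (?A - {a}) (hd xs) y"
        using successively_rtrancl_on[of "arcs_ends G" "ys @ [y]"] by simp
      then show ?thesis
        by (rule converse_rtrancl_on_into_rtrancl_on[OF c(1)]) (use that in auto)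
    qed
  qed
  have path: "reach_in (set xs) (hd xs) y" if y: "y \<in> set xs" for y
  proof -
    obtain ys zs where split: "xs = ys @ y # zs" using y by (meson split_list)
    moreover have "successively (\<lambda>x y. x \<rightarrow> y) (ys @ [y])"
      using xs split by (simp add: successively_append_iff)
    moreover have "hd (ys @ [y]) = hd xs" using split by (cases ys) auto
    ultimately show ?thesis
      using successively_rtrancl_on[of "arcs_ends G" "ys @ [y]" "set xs"] by auto
  qed
  show "reach_in (?A - {a}) x y" if "x \<in> ?A - {a}" "y \<in> ?A - {a}" for a x y
  proof (cases "a = c")
    case True
    then have "?A - {a} = set xs" using xs by auto
    then have "x \<in> set xs" "y \<in> set xs" using that by auto
    then have "reach_in (set xs) x y"
      by (rule rtrancl_on_trans[OF reach_in_sym[OF path] path])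
    then show ?thesis using \<open>?A - {a} = set xs\<close> by simp
  next
    case False
    show ?thesis
      by (rule rtrancl_on_trans[OF reach_in_sym[OF hub] hub]) (use False that in auto)
  qed
  show "?A \<subseteq> verts G" using verts c adj_in_verts by blast
  show "reach_in ?A x y" if "x \<in> ?A" "y \<in> ?A" for x y
  proof -
    have hub': "reach_in ?A c y" if "y \<in> ?A" for y
    proof (cases "y = c")
      case True
      then show ?thesis by (simp add: rtrancl_on_refl)
    next
      case False
      then have "reach_in ?A (hd xs) y"
        using path[of y] that rtrancl_on_mono[of "arcs_ends G" "arcs_ends G" "set xs" ?A] by auto
      then show ?thesis by (rule converse_rtrancl_on_into_rtrancl_on[OF c(1)]) auto
    qed
    show ?thesis
      by (rule rtrancl_on_trans[OF reach_in_sym[OF hub'] hub']) (use that in auto)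
  qed
qed simp

text \<open>A path from \<open>v\<close> to \<open>x\<close> avoiding \<open>c\<close> closes at
  \<open>c\<close> to a cycle, and the block containing this cycle is complete. Completeness of
  blocks enters the proof only here.\<close>

lemma block_graph_neighbours_adjacent:
  assumes "block_graph G" and c: "c \<rightarrow> v" "c \<rightarrow> x" and "v \<noteq> x"
    and "reach_in (verts G - {c}) v x"
  shows "v \<rightarrow> x"
proof -
  obtain xs where xs: "successively (\<lambda>u v. u \<rightarrow> v) xs" "distinct xs" "xs \<noteq> []"
    "set xs \<subseteq> verts G - {c}" "hd xs = v" "last xs = x"
    using rtrancl_on_distinct_path[OF assms(5)] by metis
  then have "nonseparable (insert c (set xs))"
    using c by (intro cycle_nonseparable) auto
  then obtain B where B: "block G B" "insert c (set xs) \<subseteq> verts B"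
    by (rule nonseparable_in_block)
  then have "complete_digraph (card (verts B)) B"
    using \<open>block_graph G\<close> by (simp add: block_graph_def)
  then have "arcs_ends B = {(u, v). (u, v) \<in> verts B \<times> verts B \<and> u \<noteq> v}"
    by (simp add: complete_digraph_def)
  moreover have "v \<in> verts B" "x \<in> verts B" using xs B by auto
  ultimately have "v \<rightarrow>\<^bsub>B\<^esub> x" using \<open>v \<noteq> x\<close> by auto
  moreover have "B = G \<restriction> verts B" using B induced_subgraph_eq by (simp add: block_def)
  ultimately show ?thesis by (metis dominates_induce_subgraphD)
qed

end


section \<open>Forts\<close>

text \<open>The final observed set as a least fixed point, independent of the order of steps. Unlike
  \<open>pd_step\<close>, \<open>force\<close> does not ask \<open>w\<close> to be unobserved, so
  the closure is monotone in \<open>X\<close>.\<close>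

inductive_set pd_closure :: "('a, 'b) pre_digraph \<Rightarrow> 'a set \<Rightarrow> 'a set" for G X where
  start: "x \<in> X \<Longrightarrow> x \<in> pd_closure G X"
| force: "v \<in> pd_closure G X \<Longrightarrow> v \<rightarrow>\<^bsub>G\<^esub> w \<Longrightarrow>
    (\<And>u. v \<rightarrow>\<^bsub>G\<^esub> u \<Longrightarrow> u \<noteq> w \<Longrightarrow> u \<in> pd_closure G X) \<Longrightarrow> w \<in> pd_closure G X"

lemma pd_closure_least:
  assumes "X \<subseteq> pd_closure G Y"
  shows "pd_closure G X \<subseteq> pd_closure G Y"
proof
  fix x assume "x \<in> pd_closure G X"
  then show "x \<in> pd_closure G Y"
    by induction (use assms in \<open>auto intro: pd_closure.force\<close>)
qed

lemma pd_closure_mono: "X \<subseteq> Y \<Longrightarrow> pd_closure G X \<subseteq> pd_closure G Y"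
  by (rule pd_closure_least) (auto intro: pd_closure.start)

lemma closed_neighborhood_mono:
  "S \<subseteq> T \<Longrightarrow> closed_neighborhood G S \<subseteq> closed_neighborhood G T"
  by (auto simp: closed_neighborhood_def)

definition fort :: "('a, 'b) pre_digraph \<Rightarrow> 'a set \<Rightarrow> bool" where
  "fort G F \<longleftrightarrow> F \<noteq> {} \<and> F \<subseteq> verts G \<and>
     (\<forall>v. v \<notin> F \<longrightarrow> (\<nexists>w. {u. v \<rightarrow>\<^bsub>G\<^esub> u \<and> u \<in> F} = {w}))"

text \<open>A vertex outside the complement with exactly one neighbour in it would be observed and
  would force that neighbour.\<close>

lemma fort_complement_pd_closure:
  assumes "\<not> verts G \<subseteq> pd_closure G X" "\<And>u v. u \<rightarrow>\<^bsub>G\<^esub> v \<Longrightarrow> u \<in> verts G \<and> v \<in> verts G"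
  shows "fort G (verts G - pd_closure G X)"
  unfolding fort_def
proof (intro conjI allI impI notI)
  fix v assume v: "v \<notin> verts G - pd_closure G X"
    and "\<exists>w. {u. v \<rightarrow>\<^bsub>G\<^esub> u \<and> u \<in> verts G - pd_closure G X} = {w}"
  then obtain w where "{u. v \<rightarrow>\<^bsub>G\<^esub> u \<and> u \<in> verts G - pd_closure G X} = {w}" by blast
  then have w: "v \<rightarrow>\<^bsub>G\<^esub> w" "w \<notin> pd_closure G X"
    and "\<And>u. v \<rightarrow>\<^bsub>G\<^esub> u \<Longrightarrow> u \<noteq> w \<Longrightarrow> u \<in> pd_closure G X"
    using assms(2) by blast+
  then show False using assms(2) v pd_closure.force[of v G X w] by blast
qed (use assms in auto)

context graph
begin

text \<open>If \<open>S\<close> misses the closed neighbourhood of \<open>F\<close>, the start set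
  misses \<open>F\<close>. Afterwards no vertex of \<open>F\<close> can be the first to be observed:
  the vertex forcing it would lie outside \<open>F\<close> and have it as its only neighbour in
  \<open>F\<close>.\<close>

lemma power_dominating_set_meets_fort:
  assumes "power_dominating_set G S" "fort G F"
  shows "S \<inter> closed_neighborhood G F \<noteq> {}"
proof
  assume disj: "S \<inter> closed_neighborhood G F = {}"
  have "X \<inter> F = {}" if "(pd_step G)\<^sup>*\<^sup>* (closed_neighborhood G S) X" for X
    using that
  proof (induction rule: rtranclp_induct)
    case base
    show ?case using disj adj_commute unfolding closed_neighborhood_def by blast
  next
    case (step Y Z)
    from step.hyps(2) obtain v w where v: "v \<in> Y" "{u. v \<rightarrow> u \<and> u \<notin> Y} = {w}" and Z: "Z = insert w Y"
      by cases auto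
    have "w \<notin> F"
    proof
      assume "w \<in> F"
      then have "{u. v \<rightarrow> u \<and> u \<in> F} = {w}" using v step.IH by blast
      then show False using assms(2) v step.IH unfolding fort_def by blast
    qed
    then show ?case using step.IH Z by simp
  qed
  moreover have "(pd_step G)\<^sup>*\<^sup>* (closed_neighborhood G S) (verts G)"
    using assms(1) by (simp add: power_dominating_set_def)
  ultimately have "verts G \<inter> F = {}" by blast
  then show False using assms(2) unfolding fort_def by blast
qed

lemma pd_steps_to_verts:
  assumes "X \<subseteq> verts G" "verts G \<subseteq> pd_closure G X"
  shows "(pd_step G)\<^sup>*\<^sup>* X (verts G)"
proof -
  let ?R = "{Y. (pd_step G)\<^sup>*\<^sup>* X Y}"
  have sub: "X \<subseteq> Y \<and> Y \<subseteq> verts G" if "(pd_step G)\<^sup>*\<^sup>* X Y" for Y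
    using that
  proof (induction rule: rtranclp_induct)
    case (step Y Z)
    from step.hyps(2) obtain v w where "v \<rightarrow> w" "Z = insert w Y"
      by cases blast
    then show ?case using step.IH adj_in_verts by blast
  qed (use assms in simp)
  have "finite ?R" by (rule finite_subset[of _ "Pow (verts G)"]) (use sub in auto)
  \<comment> \<open>A maximal set reached by the process is closed under \<open>force\<close>, so it
    contains the closure.\<close>
  then obtain Y where Y: "(pd_step G)\<^sup>*\<^sup>* X Y" and max: "\<And>Z. (pd_step G)\<^sup>*\<^sup>* X Z \<Longrightarrow> Y \<subseteq> Z \<Longrightarrow> Y = Z"
    using finite_has_maximal[of ?R] by blast
  have "pd_closure G X \<subseteq> Y"
  proof
    fix x assume "x \<in> pd_closure G X"
    then show "x \<in> Y"
    proof induction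
      case (force v w)
      show ?case
      proof (rule ccontr)
        assume "w \<notin> Y"
        then have "{u. v \<rightarrow> u \<and> u \<notin> Y} = {w}" using force by blast
        then have "pd_step G Y (insert w Y)" using force by (intro pd_step.intros)
        then have "Y = insert w Y" using max Y by (meson rtranclp.rtrancl_into_rtrancl subset_insertI)
        then show False using \<open>w \<notin> Y\<close> by blast
      qed
    qed (use sub[OF Y] in auto)
  qed
  then have "Y = verts G" using assms sub[OF Y] by blast
  then show ?thesis using Y by simp
qed

end


section \<open>Optimal fort packings in block graphs\<close>

locale rooted_block_graph = graph G for G :: "('a, 'b) pre_digraph" (structure) +
  fixes r :: 'a
  assumes block_graph: "block_graph G" and root: "r \<in> verts G"
begin

section \<open>Dominance from the root\<close>

text \<open>The subtree at \<open>v\<close> of the dominator tree of \<open>G\<close> rooted at \<open>r\<close>.\<close>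

definition below :: "'a \<Rightarrow> 'a set" where
  "below v = {u \<in> verts G. \<not> reach_in (verts G - {v}) r u}"

lemma below_verts: "u \<in> below v \<Longrightarrow> u \<in> verts G"
  by (simp add: below_def)

lemma below_refl: "v \<in> verts G \<Longrightarrow> v \<in> below v"
  using in_rtrancl_on_in_F(2) by (fastforce simp: below_def)

lemma below_root: "below r = verts G"
  using in_rtrancl_on_in_F(1) by (fastforce simp: below_def)

lemma root_below_iff: "r \<in> below v \<longleftrightarrow> v = r"
proof
  assume "r \<in> below v"
  then show "v = r" using root by (auto simp: below_def)
next
  assume "v = r"
  then show "r \<in> below v" using root below_refl by simp
qed

text \<open>A path to \<open>w\<close> avoiding \<open>v\<close> would extend along the edge to
  \<open>u\<close>. Hence \<open>below v\<close> can be left only from \<open>v\<close>.\<close>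

lemma below_adj: "u \<in> below v \<Longrightarrow> u \<noteq> v \<Longrightarrow> u \<rightarrow> w \<Longrightarrow> w \<in> below v"
  using adj_in_verts adj_commute unfolding below_def
  by (auto intro: rtrancl_on_into_rtrancl_on)

lemma reach_root: "v \<in> verts G \<Longrightarrow> reach_in (verts G) r v"
  using block_graph root symmetric_connected_imp_strongly_connected sym_arcs
  unfolding block_graph_def strongly_connected_def reachable_def by blast

text \<open>A walk from \<open>r\<close> that avoids \<open>v\<close> cannot visit \<open>u\<close>,
  so it avoids \<open>u\<close> as well.\<close>

lemma below_trans:
  assumes "u \<in> below v"
  shows "below u \<subseteq> below v"
proof
  fix x assume x: "x \<in> below u"
  show "x \<in> below v"
  proof (rule ccontr)
    assume "x \<notin> below v"
    then have "reach_in (verts G - {v}) r x" using x by (simp add: below_def)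
    then have "reach_in (verts G - {u}) r x"
    proof (induction rule: rtrancl_on_induct)
      case base
      then show ?case using assms root_below_iff by auto
    next
      case (step y z)
      then have "reach_in (verts G - {v}) r z" by (meson rtrancl_on_into_rtrancl_on)
      then have "z \<noteq> u" using assms by (auto simp: below_def)
      with step show ?case by (meson DiffD1 DiffI rtrancl_on_into_rtrancl_on singletonD)
    qed
    with x show False by (simp add: below_def)
  qed
qed

text \<open>If distinct \<open>u\<close> and \<open>v\<close> dominated each other, no walk from
  \<open>r\<close> could reach one of them first, so neither would ever be reached, although
  \<open>G\<close> is connected.\<close>

lemma below_antisym:
  assumes "u \<in> below v" "v \<in> below u"
  shows "u = v"
proof (rule ccontr)
  assume "u \<noteq> v"
  have "reach_in (verts G - {u}) r y \<and> reach_in (verts G - {v}) r y" if "reach_in (verts G) r y" for y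
    using that
  proof (induction rule: rtrancl_on_induct)
    case base
    then show ?case using \<open>u \<noteq> v\<close> assms root_below_iff by auto
  next
    case (step y z)
    have "z \<noteq> u"
      using assms(1) \<open>u \<noteq> v\<close> step reach_in_delete_step[of r y v z] by (auto simp: below_def)
    moreover have "z \<noteq> v"
      using assms(2) \<open>u \<noteq> v\<close> step reach_in_delete_step[of r y u z] by (auto simp: below_def)
    ultimately show ?case using step reach_in_delete_step by blast
  qed
  then show False using assms reach_root by (auto simp: below_def)
qed

text \<open>Along a walk from \<open>r\<close>, each vertex is reached avoiding \<open>u\<close> or
  avoiding \<open>v\<close>: when the walk hits \<open>u\<close>, it is replaced by one to
  \<open>u\<close> that avoids \<open>v\<close>, and vice versa.\<close>

lemma below_disjoint:
  assumes "u \<in> verts G" "v \<in> verts G" "u \<notin> below v" "v \<notin> below u"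
  shows "below u \<inter> below v = {}"
proof -
  have "u \<noteq> v" using assms below_refl by blast
  have u: "reach_in (verts G - {v}) r u" and v: "reach_in (verts G - {u}) r v"
    using assms by (auto simp: below_def)
  have "reach_in (verts G - {u}) r y \<or> reach_in (verts G - {v}) r y" if "reach_in (verts G) r y" for y
    using that
  proof (induction rule: rtrancl_on_induct)
    case base
    then show ?case using \<open>u \<noteq> v\<close> by auto
  next
    case (step y z)
    then show ?case using u v
      by (metis DiffI rtrancl_on_into_rtrancl_on singletonD)
  qed
  then show ?thesis using reach_root by (auto simp: below_def)
qed

text \<open>\<open>x\<close> lies in \<open>below v\<close> but is reached from \<open>r\<close>
  without \<open>c\<close>. Such a walk enters \<open>below v\<close> through \<open>v\<close>, so
  \<open>v\<close> and \<open>x\<close> are joined outside \<open>c\<close>; both are neighbours of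
  \<open>c\<close>, hence adjacent.\<close>

lemma child_neighbour:
  assumes "v \<rightarrow> c" "c \<in> below v" "c \<rightarrow> x" "x \<notin> below c" "x \<noteq> v"
  shows "v \<rightarrow> x"
proof -
  have "c \<noteq> v" using assms(1) adj_not_same by blast
  have "x \<in> below v" using assms below_adj \<open>c \<noteq> v\<close> by blast
  have "y \<in> below v \<longrightarrow> reach_in (verts G - {c}) v y" if "reach_in (verts G - {c}) r y" for y
    using that
  proof (induction rule: rtrancl_on_induct)
    case base
    then show ?case using root_below_iff by auto
  next
    case (step y z)
    show ?case
    proof
      assume z: "z \<in> below v"
      show "reach_in (verts G - {c}) v z"
      proof (cases "z = v")
        case True
        then show ?thesis using step by auto
      next
        case False
        then have "y \<in> below v" using z below_adj adj_commute step by blast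
        then show ?thesis using step by (meson rtrancl_on_into_rtrancl_on)
      qed
    qed
  qed
  then have "reach_in (verts G - {c}) v x"
    using \<open>x \<in> below v\<close> assms(4) by (auto simp: below_def)
  then show ?thesis
    using block_graph_neighbours_adjacent[OF block_graph, of c v x] assms adj_commute by blast
qed

text \<open>In a general graph, \<open>v\<close> may be the immediate dominator of a vertex not
  adjacent to it. Here a walk that leaves \<open>below c\<close> for a vertex other than
  \<open>v\<close> does so from \<open>c\<close>, and by \<open>child_neighbour\<close> it steps to
  another neighbour of \<open>v\<close>.\<close>

lemma below_child:
  assumes "u \<in> below v" "u \<noteq> v"
  obtains c where "v \<rightarrow> c" "c \<in> below v" "u \<in> below c"
proof -
  have "y \<in> below v \<Longrightarrow> y \<noteq> v \<Longrightarrow> \<exists>c. v \<rightarrow> c \<and> c \<in> below v \<and> y \<in> below c"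
    if "reach_in (verts G) r y" for y
    using that
  proof (induction rule: rtrancl_on_induct)
    case base
    then show ?case using root_below_iff by auto
  next
    case (step y z)
    then have y: "y \<in> below v" using below_adj adj_commute by blast
    show ?case
    proof (cases "y = v")
      case True
      then show ?thesis using step below_refl by blast
    next
      case False
      then obtain c where c: "v \<rightarrow> c" "c \<in> below v" "y \<in> below c" using step y by blast
      then show ?thesis
        using step child_neighbour[of v c z] below_adj[of y c z] below_refl by blast
    qed
  qed
  then show thesis using that assms reach_root below_verts by blast
qed

section \<open>The greedy power dominating set\<close>

text \<open>
  The vertices observed when \<open>A\<close> is placed strictly below \<open>v\<close> and everything outside \<open>below v\<close>,
  as well as \<open>v\<close> itself, is observed for free; the root gets no such help.
\<close>

definition helped :: "'a \<Rightarrow> 'a set \<Rightarrow> 'a set" where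
  "helped v A = pd_closure G (closed_neighborhood G A \<union> (verts G - below v) \<union> (if v = r then {} else {v}))"

text \<open>Membership of \<open>v\<close> depends only on \<open>S\<close> strictly below
  \<open>v\<close>, so \<open>S\<close> arises by well-founded recursion; the sets
  \<open>below v\<close> strictly shrink on the way down.\<close>

lemma greedy_exists:
  obtains S where "S \<subseteq> verts G"
    "\<And>v. v \<in> verts G \<Longrightarrow> v \<in> S \<longleftrightarrow> \<not> verts G \<subseteq> helped v (S \<inter> (below v - {v}))"
proof -
  define R where "R = {(u, v). v \<in> verts G \<and> u \<in> below v - {v}}"
  define H where "H = (\<lambda>f v. v \<in> verts G \<and> \<not> verts G \<subseteq> helped v {u \<in> below v - {v}. f u})"
  have "wf R"
  proof (rule wf_subset)
    show "wf (inv_image less_than (\<lambda>v. card (below v)))" by simp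
    have "card (below u) < card (below v)" if "v \<in> verts G" "u \<in> below v - {v}" for u v
    proof (rule psubset_card_mono)
      show "finite (below v)" by (simp add: below_def)
      show "below u \<subset> below v" using that below_trans below_antisym below_refl by blast
    qed
    then show "R \<subseteq> inv_image less_than (\<lambda>v. card (below v))" by (auto simp: R_def)
  qed
  define f where "f = wfrec R H"
  have f: "f v \<longleftrightarrow> v \<in> verts G \<and> \<not> verts G \<subseteq> helped v {u \<in> below v - {v}. f u}" for v
  proof -
    have "f v = H (cut f R v) v" unfolding f_def by (rule wfrec[OF \<open>wf R\<close>])
    \<comment> \<open>\<open>cut\<close> changes nothing here, as only values at vertices
      \<open>R\<close>-below \<open>v\<close> are consulted.\<close>
    moreover have "v \<in> verts G \<Longrightarrow> {u \<in> below v - {v}. cut f R v u} = {u \<in> below v - {v}. f u}"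
      by (auto simp: cut_def R_def)
    ultimately show ?thesis by (auto simp: H_def)
  qed
  show thesis
  proof (rule that)
    show "{v. f v} \<subseteq> verts G" using f by blast
    fix v assume "v \<in> verts G"
    have "{v. f v} \<inter> (below v - {v}) = {u \<in> below v - {v}. f u}" by blast
    with f[of v] \<open>v \<in> verts G\<close>
    show "v \<in> {v. f v} \<longleftrightarrow> \<not> verts G \<subseteq> helped v ({v. f v} \<inter> (below v - {v}))"
      by (simp only: mem_Collect_eq simp_thms)
  qed
qed

context
  fixes S
  assumes S_verts: "S \<subseteq> verts G"
    and greedy: "\<And>v. v \<in> verts G \<Longrightarrow> v \<in> S \<longleftrightarrow> \<not> verts G \<subseteq> helped v (S \<inter> (below v - {v}))"
begin

text \<open>
  All neighbours of a child \<open>c\<close> of \<open>v\<close> outside \<open>below c\<close> lie in \<open>N[v]\<close>, so a placed \<open>v\<close>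
  provides exactly the help that the greedy rule at \<open>c\<close> assumed.
\<close>

lemma helped_child:
  assumes "v \<rightarrow> c" "c \<in> below v" "A \<subseteq> B" "v \<in> B"
  shows "helped c A \<inter> below c \<subseteq> pd_closure G (closed_neighborhood G B)"
proof -
  let ?Y = "pd_closure G (closed_neighborhood G B)"
  have near: "u \<in> ?Y" if "u = v \<or> v \<rightarrow> u" for u
    using that assms(4) by (auto simp: closed_neighborhood_def intro!: pd_closure.start)
  \<comment> \<open>The claim is confined to \<open>below c\<close>. A force onto a vertex of
    \<open>below c\<close> other than \<open>c\<close> comes from inside \<open>below c\<close>, and
    outside neighbours matter only when it comes from \<open>c\<close>.\<close>
  have "y \<in> below c \<longrightarrow> y \<in> ?Y" if "y \<in> helped c A" for y
    using that unfolding helped_def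
  proof induction
    case (start x)
    then show ?case
      using near[of c] assms(1) closed_neighborhood_mono[OF assms(3), of G]
      by (auto split: if_splits intro: pd_closure.start)
  next
    case (force a w)
    show ?case
    proof
      assume w: "w \<in> below c"
      show "w \<in> ?Y"
      proof (cases "w = c")
        case True
        then show ?thesis using near assms(1) by simp
      next
        case False
        then have a: "a \<in> below c" using w force below_adj adj_commute by blast
        have "u \<in> ?Y" if "a \<rightarrow> u" "u \<noteq> w" for u
        proof (cases "u \<in> below c")
          case False
          then have "a = c" using a that below_adj by blast
          then have "u = v \<or> v \<rightarrow> u" using child_neighbour assms that False by blast
          then show ?thesis by (rule near)
        qed (use force that in blast)
        then show ?thesis using force a by (meson pd_closure.force)
      qed
    qed
  qed
  then show ?thesis by blast
qed

text \<open>Every \<open>u\<close> other than \<open>v\<close> lies below a child \<open>c\<close>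
  of \<open>v\<close>. If \<open>c\<close> is in \<open>S\<close>, induction applies; if not, the
  greedy rule rejected \<open>c\<close> because help at \<open>c\<close> suffices, and
  \<open>v\<close> provides this help.\<close>

lemma below_observed:
  assumes "v \<in> S"
  shows "below v \<subseteq> pd_closure G (closed_neighborhood G (S \<inter> below v))"
  using assms
proof (induction "card (below v)" arbitrary: v rule: less_induct)
  case less
  let ?Y = "pd_closure G (closed_neighborhood G (S \<inter> below v))"
  have v: "v \<in> S \<inter> below v" using less S_verts below_refl by blast
  show ?case
  proof
    fix u assume u: "u \<in> below v"
    show "u \<in> ?Y"
    proof (cases "u = v")
      case True
      then show ?thesis using v by (auto simp: closed_neighborhood_def intro: pd_closure.start)
    next
      case False
      then obtain c where c: "v \<rightarrow> c" "c \<in> below v" "u \<in> below c" using u below_child by metis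
      have sub: "below c \<subseteq> below v" using c below_trans by blast
      show ?thesis
      proof (cases "c \<in> S")
        case True
        have "v \<notin> below c" using c below_antisym adj_not_same by blast
        then have "below c \<subset> below v" using sub v by blast
        then have "card (below c) < card (below v)"
          by (intro psubset_card_mono) (simp_all add: below_def)
        then have "below c \<subseteq> pd_closure G (closed_neighborhood G (S \<inter> below c))"
          using less True by blast
        also have "\<dots> \<subseteq> ?Y"
          using sub by (intro pd_closure_mono closed_neighborhood_mono) blast
        finally show ?thesis using c by blast
      next
        case False
        then have "verts G \<subseteq> helped c (S \<inter> (below c - {c}))"
          using greedy c below_verts by blast
        moreover have "helped c (S \<inter> (below c - {c})) \<inter> below c \<subseteq> ?Y"
          using c sub v by (intro helped_child) auto
        ultimately show ?thesis using c below_verts by blast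
      qed
    qed
  qed
qed

text \<open>If \<open>r\<close> is not chosen, the greedy rule at \<open>r\<close> already says that
  \<open>S\<close> suffices, since the root receives no help; otherwise
  \<open>below_observed\<close> applies to \<open>r\<close>.\<close>

lemma greedy_power_dominating: "power_dominating_set G S"
proof -
  have "verts G \<subseteq> pd_closure G (closed_neighborhood G S)"
  proof (cases "r \<in> S")
    case True
    then show ?thesis
      using below_observed[of r] S_verts by (simp add: below_root Int_absorb2)
  next
    case False
    then have "verts G \<subseteq> helped r (S \<inter> (below r - {r}))" using greedy root by blast
    also have "\<dots> \<subseteq> pd_closure G (closed_neighborhood G S)"
      unfolding helped_def by (auto simp: below_root intro!: pd_closure_mono closed_neighborhood_mono)
    finally show ?thesis .
  qed
  moreover have "closed_neighborhood G S \<subseteq> verts G"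
    using S_verts adj_in_verts by (auto simp: closed_neighborhood_def)
  ultimately show ?thesis
    using S_verts pd_steps_to_verts by (simp add: power_dominating_set_def)
qed

section \<open>Forts left by the greedy choice\<close>

definition greedy_fort :: "'a \<Rightarrow> 'a set" where
  "greedy_fort v = verts G - helped v (S \<inter> (below v - {v}))"

lemma fort_greedy_fort: "v \<in> S \<Longrightarrow> fort G (greedy_fort v)"
  using greedy S_verts adj_in_verts unfolding greedy_fort_def helped_def
  by (intro fort_complement_pd_closure) blast+

lemma greedy_fort_below:
  shows "greedy_fort v \<subseteq> below v" and "v \<noteq> r \<Longrightarrow> v \<notin> greedy_fort v"
  by (auto simp: greedy_fort_def helped_def intro: pd_closure.start)

text \<open>For \<open>v\<close> other than \<open>r\<close>, the fort avoids \<open>v\<close>, the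
  only vertex of \<open>below v\<close> with neighbours outside.\<close>

lemma neighborhood_greedy_fort: "closed_neighborhood G (greedy_fort v) \<subseteq> below v"
proof (cases "v = r")
  case True
  then show ?thesis
    using greedy_fort_below(1)[of v] adj_in_verts by (auto simp: closed_neighborhood_def below_root)
next
  case False
  then show ?thesis
    using greedy_fort_below[of v] below_adj[of _ v] unfolding closed_neighborhood_def by blast
qed

text \<open>The part of \<open>S\<close> in \<open>below u\<close> observes \<open>below u\<close>
  and all neighbours of \<open>u\<close>, and it is available when \<open>v\<close> is judged. So
  the fort of \<open>v\<close> misses these vertices, and every edge leaving \<open>below u\<close>
  starts at \<open>u\<close>.\<close>

lemma greedy_fort_disjoint_below:
  assumes "u \<in> S" "u \<in> below v" "u \<noteq> v"
  shows "closed_neighborhood G (greedy_fort v) \<inter> below u = {}"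
proof -
  have "v \<notin> below u" using assms below_antisym by blast
  moreover have "below u \<subseteq> below v" using assms below_trans by blast
  ultimately have "S \<inter> below u \<subseteq> S \<inter> (below v - {v})" by blast
  then have "pd_closure G (closed_neighborhood G (S \<inter> below u)) \<subseteq> helped v (S \<inter> (below v - {v}))"
    unfolding helped_def by (intro pd_closure_mono) (use closed_neighborhood_mono in blast)
  then have F: "greedy_fort v \<inter> below u = {}"
    using below_observed[OF assms(1)] unfolding greedy_fort_def by blast
  have "y \<notin> greedy_fort v" if "u \<rightarrow> y" for y
    using that assms unfolding greedy_fort_def helped_def closed_neighborhood_def
    by (auto intro: pd_closure.start)
  then show ?thesis
    using F below_adj adj_commute unfolding closed_neighborhood_def by blast
qed

text \<open>In the dominator order, \<open>u\<close> and \<open>v\<close> are comparable or have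
  disjoint subtrees.\<close>

lemma greedy_forts_disjoint:
  assumes "u \<in> S" "v \<in> S" "u \<noteq> v"
  shows "closed_neighborhood G (greedy_fort u) \<inter> closed_neighborhood G (greedy_fort v) = {}"
proof -
  consider "u \<in> below v" | "v \<in> below u" | "below u \<inter> below v = {}"
    using below_disjoint assms S_verts by blast
  then show ?thesis
    using greedy_fort_disjoint_below[of u v] greedy_fort_disjoint_below[of v u]
      neighborhood_greedy_fort[of u] neighborhood_greedy_fort[of v] assms by cases blast+
qed

end

end

lemma block_graph_fort_packing:
  assumes "block_graph G"
  obtains S F where "power_dominating_set G S" "finite S" "\<And>v. v \<in> S \<Longrightarrow> fort G (F v)"
    "disjoint_family_on (\<lambda>v. closed_neighborhood G (F v)) S"
proof -
  interpret graph G using assms by (simp add: block_graph_def)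
  obtain r where "r \<in> verts G"
    using assms by (auto simp: block_graph_def connected_conv)
  then interpret rooted_block_graph G r by unfold_locales (use assms in auto)
  obtain S where S: "S \<subseteq> verts G"
    "\<And>v. v \<in> verts G \<Longrightarrow> v \<in> S \<longleftrightarrow> \<not> verts G \<subseteq> helped v (S \<inter> (below v - {v}))"
    using greedy_exists by blast
  show thesis
  proof (rule that)
    show "power_dominating_set G S" using greedy_power_dominating[OF S] .
    show "finite S" using S(1) finite_subset[of S "verts G"] by simp
    show "fort G (greedy_fort S v)" if "v \<in> S" for v using fort_greedy_fort[OF S that] .
    show "disjoint_family_on (\<lambda>v. closed_neighborhood G (greedy_fort S v)) S"
      using greedy_forts_disjoint[OF S] by (simp add: disjoint_family_on_def)
  qed
qed


section \<open>Robust power domination\<close>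

text \<open>\<open>A\<close> is topped up with entries from a listing of
  \<open>B - A\<close>.\<close>

lemma mset_subset_interpolate:
  assumes "A \<subseteq># B" "size A \<le> n" "n \<le> size B"
  obtains C where "A \<subseteq># C" "C \<subseteq># B" "size C = n"
proof -
  obtain xs where xs: "mset xs = B - A" using ex_mset by blast
  let ?C = "A + mset (take (n - size A) xs)"
  have "mset (take (n - size A) xs) \<subseteq># mset (take (n - size A) xs) + mset (drop (n - size A) xs)"
    by (rule mset_subset_eq_add_left)
  also have "\<dots> = B - A" by (simp flip: mset_append add: xs)
  finally have "?C \<subseteq># B"
    using assms(1) by (metis subset_mset.add_diff_inverse subset_mset.add_left_mono)
  moreover have "length xs = size B - size A"
    using xs assms(1) by (metis size_Diff_submset size_mset)
  then have "size ?C = n" using assms by simp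
  ultimately show thesis using that[of ?C] by simp
qed

text \<open>Otherwise some \<open>K\<close> of size exactly \<open>k\<close> takes away all elements
  of \<open>M\<close> in the neighbourhood, and what remains contains no power dominating set, as
  each of these meets the neighbourhood.\<close>

lemma (in graph) k_rPDS_meets_fort:
  assumes "k_rPDS k G M" "fort G F"
  shows "k < size (filter_mset (\<lambda>x. x \<in> closed_neighborhood G F) M)"
proof (rule ccontr)
  let ?N = "filter_mset (\<lambda>x. x \<in> closed_neighborhood G F) M"
  assume "\<not> k < size ?N"
  moreover have "k \<le> size M" using assms by (simp add: k_rPDS_def)
  ultimately obtain K where K: "?N \<subseteq># K" "K \<subseteq># M" "size K = k"
    using mset_subset_interpolate[of ?N M k] by (auto simp: not_less)
  then obtain T where T: "T \<subseteq> set_mset (M - K)" "power_dominating_set G T"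
    using assms(1) unfolding k_rPDS_def by blast
  then obtain x where x: "x \<in> T" "x \<in> closed_neighborhood G F"
    using power_dominating_set_meets_fort assms(2) by blast
  then have "count K x < count M x" using T by (auto simp: in_diff_count)
  moreover have "count M x \<le> count K x"
    using mset_subset_eq_count[OF K(1), of x] x by simp
  ultimately show False by simp
qed

lemma size_ge_disjoint_parts:
  assumes "finite S" "disjoint_family_on A S" "\<And>v. v \<in> S \<Longrightarrow> n \<le> size (filter_mset (\<lambda>x. x \<in> A v) M)"
  shows "n * card S \<le> size M"
proof -
  have "n * card S \<le> size (filter_mset (\<lambda>x. x \<in> (\<Union>v\<in>S. A v)) M)"
    using assms
  proof (induction S rule: finite_induct)
    case (insert v S)
    let ?U = "\<Union>v\<in>S. A v"
    have "A v \<inter> ?U = {}"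
      using insert by (auto simp: disjoint_family_on_def)
    then have "filter_mset (\<lambda>x. x \<in> (\<Union>v\<in>insert v S. A v)) M
        = filter_mset (\<lambda>x. x \<in> A v) M + filter_mset (\<lambda>x. x \<in> ?U) M"
      by (intro multiset_eqI) auto
    moreover have "n * card S \<le> size (filter_mset (\<lambda>x. x \<in> ?U) M)"
      using insert by (intro insert.IH) (auto simp: disjoint_family_on_def)
    moreover have "n \<le> size (filter_mset (\<lambda>x. x \<in> A v) M)" using insert by simp
    ultimately show ?case using insert.hyps by (simp add: add_mono)
  qed simp
  also have "\<dots> \<le> size M" by (simp add: size_mset_mono)
  finally show ?thesis .
qed

text \<open>Removing \<open>k\<close> elements cannot remove all \<open>k + 1\<close> copies of a
  vertex.\<close>

lemma (in graph) k_rPDS_copies: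
  assumes "power_dominating_set G S" "finite S" "S \<noteq> {}"
  shows "k_rPDS k G (repeat_mset (Suc k) (mset_set S))"
proof -
  let ?M = "repeat_mset (Suc k) (mset_set S)"
  have set: "set_mset ?M = S" using assms(2) by (induction k) auto
  have "S \<subseteq> set_mset (?M - F)" if "size F = k" for F
  proof
    fix v assume "v \<in> S"
    then have "count ?M v = Suc k" using assms(2) by simp
    moreover have "count F v \<le> k" using that count_le_size by metis
    ultimately show "v \<in># ?M - F" by (simp add: in_diff_count)
  qed
  \<comment> \<open>For empty \<open>S\<close> the multiset would be empty and this would fail for
    positive \<open>k\<close>.\<close>
  moreover have "k \<le> size ?M"
    using assms(2,3) by (cases "card S") simp_all
  ultimately show ?thesis
    using assms(1) set unfolding k_rPDS_def power_dominating_set_def by blast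
qed

theorem theorem6:
  fixes G :: "('a, 'b) pre_digraph" and k :: nat
  assumes "block_graph G"
  shows "k_rPDS_number k G = (k + 1) * power_domination_number G"
proof -
  interpret graph G using assms by (simp add: block_graph_def)
  obtain S F where S: "power_dominating_set G S" "finite S" and F: "\<And>v. v \<in> S \<Longrightarrow> fort G (F v)"
    and disj: "disjoint_family_on (\<lambda>v. closed_neighborhood G (F v)) S"
    using block_graph_fort_packing[OF assms] by blast
  \<comment> \<open>The bound is kept general in \<open>j\<close>: \<open>j = 0\<close> serves the
    power domination number, \<open>j = k\<close> the robust one.\<close>
  have lower: "(j + 1) * card S \<le> size M" if "k_rPDS j G M" for j M
    using size_ge_disjoint_parts[OF S(2) disj, of "j + 1"] k_rPDS_meets_fort[OF that F] by force
  \<comment> \<open>From an empty observed set no step is possible, so the empty set could dominate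
    only an empty graph.\<close>
  have "S \<noteq> {}"
  proof
    assume "S = {}"
    then have "verts G = {}"
      using S(1) by (auto simp: power_dominating_set_def closed_neighborhood_def
          elim: converse_rtranclpE pd_step.cases)
    then show False using assms by (simp add: block_graph_def connected_conv)
  qed
  have "power_domination_number G = card S"
    unfolding power_domination_number_def
  proof (rule Least_equality)
    fix n assume "\<exists>T. power_dominating_set G T \<and> card T = n"
    then obtain T where T: "power_dominating_set G T" "card T = n" by blast
    then have "finite T" using finite_subset[of T "verts G"] by (simp add: power_dominating_set_def)
    then have "k_rPDS 0 G (mset_set T)"
      using T by (auto simp: k_rPDS_def power_dominating_set_def)
    then show "card S \<le> n" using lower T by fastforce
  qed (use S in blast)
  moreover have "k_rPDS_number k G = (k + 1) * card S"
    unfolding k_rPDS_number_def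
  proof (rule Least_equality)
    show "\<exists>M. k_rPDS k G M \<and> size M = (k + 1) * card S"
      using k_rPDS_copies[OF S \<open>S \<noteq> {}\<close>] by (intro exI conjI) auto
  qed (use lower in blast)
  ultimately show ?thesis by simp
qed

end
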